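(* Fix a voting protocol. If CONSTRUCTIVE-COALITIONAL-WEIGHTED-MANIPULATION (CCWM) is $\mathcal{NP}$-hard for this protocol, then UNCERTAIN-VOTES-CONSTRUCTIVE-WEIGHTED-EVALUATION (UVCWE) is also $\mathcal{NP}$-hard for it; moreover, for any $k$, if CCWM restricted to instances with $k$ candidates is $\mathcal{NP}$-hard, then so is UVCWE restricted to instances with $k$ candidates. Both statements hold even if in UVCWE the votes are drawn independently and only the following two types of (marginal) distributions of a single vote are allowed: 1) the vote's distribution is uniform over all possible votes, and 2) the vote's distribution puts all of the probability mass on a single vote.
   Context: An election consists of a set of candidates, a set of voters each casting a vote (a total order on the candidates), and a winner determination function given by the voting protocol. Voters have nonnegative integer weights, encoded in binary; a vote of weight $k$ is interpreted as $k$ identical unweighted votes. If the protocol leaves ties unresolved, they are broken against the preferred candidate $p$ (the same way in both problems below). CCWM (for a given protocol): given a set $S$ of weighted votes, the weights for a set $T$ of votes that are still open, and a preferred candidate $p$, decide whether the votes in $T$ can be cast so that $p$ wins the election determined by the votes in $S\cup T$. UVCWE (for a given protocol): given a weight for each voter, a distribution over all the votes, a candidate $p$, and a number $r$ with $0\le r\le 1$, decide whether the probability that $p$ wins is greater than $r$. For distributions of the restricted kind, the input states, for each voter, either "uniform" or the single vote on which the distribution is concentrated. *)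

theory Defs
  imports "HOL-Probability.Probability" "HOL-Combinatorics.Multiset_Permutations"
    "HOL-Computational_Algebra.Polynomial"
begin

section \<open>Turing machines\<close>

text \<open>
  Machines have a single two-way infinite tape and are given by a set of quintuples
  \<open>(state, scanned symbol, new state, written symbol, move)\<close>.  States and symbols are
  natural numbers; finiteness of the set of quintuples makes the state set and the alphabet
  finite.  State 0 is initial, state 1 is the halting state, symbol 0 is the blank.
  The tape is addressed relative to the head, which always scans cell 0, so a move shifts
  the tape.
\<close>

datatype move = Move_Left | Move_Right | Stay

type_synonym machine = "(nat \<times> nat \<times> nat \<times> nat \<times> move) set"
type_synonym config = "nat \<times> (int \<Rightarrow> nat)"

fun shift :: "move \<Rightarrow> (int \<Rightarrow> nat) \<Rightarrow> int \<Rightarrow> nat" where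
  "shift Move_Left t = (\<lambda>i. t (i - 1))"
| "shift Move_Right t = (\<lambda>i. t (i + 1))"
| "shift Stay t = t"

definition turing_machine :: "machine \<Rightarrow> bool" where
  "turing_machine M \<longleftrightarrow> finite M \<and> (\<forall>(q, _) \<in> M. q \<noteq> 1)"

definition deterministic :: "machine \<Rightarrow> bool" where
  "deterministic M \<longleftrightarrow> (\<forall>q a x y. (q, a, x) \<in> M \<longrightarrow> (q, a, y) \<in> M \<longrightarrow> x = y)"

definition step :: "machine \<Rightarrow> config rel" where
  "step M = {((q, t), (q', shift d (t(0 := b)))) | q t q' b d. (q, t 0, q', b, d) \<in> M}"

definition word_tape :: "bool list \<Rightarrow> int \<Rightarrow> nat" where
  "word_tape w i =
     (if 0 \<le> i \<and> i < int (length w) then (if w ! nat i then 2 else 1) else 0)"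

text \<open>
  Functions are computed with a clean final tape: on halting, the head scans the first
  letter of the output word and all other cells are blank.
\<close>

definition polytime :: "(bool list \<Rightarrow> bool list) \<Rightarrow> bool" where
  "polytime f \<longleftrightarrow> (\<exists>M (b :: nat poly). turing_machine M \<and> deterministic M \<and>
     (\<forall>x. \<exists>n \<le> poly b (length x).
        ((0, word_tape x), (1, word_tape (f x))) \<in> step M ^^ n))"

text \<open>Without a determinism requirement the same machines serve as nondeterministic acceptors.\<close>

definition NP :: "bool list set set" where
  "NP = {L. \<exists>M (b :: nat poly). turing_machine M \<and>
     (\<forall>x. x \<in> L \<longleftrightarrow>
        (\<exists>n \<le> poly b (length x). \<exists>t. ((0, word_tape x), (1, t)) \<in> step M ^^ n))}"


section \<open>Decision problems and hardness\<close>

text \<open>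
  A decision problem is a pair (instances, yes-instances).  Restricting a problem means
  restricting its instances, and a many-one reduction has to map instances to instances.
\<close>

type_synonym problem = "bool list set \<times> bool list set"

definition poly_reducible :: "problem \<Rightarrow> problem \<Rightarrow> bool" where
  "poly_reducible P Q \<longleftrightarrow> (\<exists>f. polytime f \<and>
     (\<forall>x \<in> fst P. f x \<in> fst Q \<and> (x \<in> snd P \<longleftrightarrow> f x \<in> snd Q)))"

definition NP_hard :: "problem \<Rightarrow> bool" where
  "NP_hard P \<longleftrightarrow> (\<forall>L \<in> NP. poly_reducible (UNIV, L) P)"


section \<open>Encoding of structured data as words\<close>

text \<open>
  Data are written as bracketed expressions over the four letters 0, 1, opening and closing
  bracket, each of which is coded by two bits.  Numbers are written in binary, most
  significant digit first; as the number 0 has one digit, it differs from the empty list.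
\<close>

datatype data = Num nat | Lst "data list"

fun binary :: "nat \<Rightarrow> bool list" where
  "binary n = (if n < 2 then [n = 1] else binary (n div 2) @ [odd n])"

declare binary.simps [simp del]

fun encode :: "data \<Rightarrow> bool list" where
  "encode (Num n) = [True, False] @ concat (map (\<lambda>d. [False, d]) (binary n)) @ [True, True]"
| "encode (Lst xs) = [True, False] @ concat (map encode xs) @ [True, True]"

text \<open>Only used for nonnegative rationals.\<close>

definition rat_data :: "rat \<Rightarrow> data" where
  "rat_data q = Lst [Num (nat (fst (quotient_of q))), Num (nat (snd (quotient_of q)))]"


section \<open>Elections and protocols\<close>

text \<open>
  The candidates of an election with \<open>m\<close> candidates are \<open>0, \<dots>, m - 1\<close>.  A vote is a total
  order on them, listed from the most to the least preferred candidate, so the votes are the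
  elements of \<^term>\<open>permutations_of_set {..<m}\<close>.

  A protocol maps the number of candidates and the list of all unweighted votes to the set of
  winners, which has several elements if the protocol leaves a tie.  Ties are broken against
  the preferred candidate, who therefore wins iff no other candidate is among the winners.
  An anonymous protocol is one that depends on the list of votes only through its multiset;
  this is not required.
\<close>

type_synonym vote = "nat list"
type_synonym protocol = "nat \<Rightarrow> vote list \<Rightarrow> nat set"

definition unweighted :: "(nat \<times> vote) list \<Rightarrow> vote list" where
  "unweighted wvs = concat (map (\<lambda>(w, v). replicate w v) wvs)"

definition wins :: "protocol \<Rightarrow> nat \<Rightarrow> nat \<Rightarrow> (nat \<times> vote) list \<Rightarrow> bool" where
  "wins W m p wvs \<longleftrightarrow> W m (unweighted wvs) = {p}"

definition candidates_data :: "nat \<Rightarrow> data" where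
  "candidates_data m = Lst (map Num [0..<m])"

definition vote_data :: "vote \<Rightarrow> data" where
  "vote_data v = Lst (map Num v)"


section \<open>Constructive coalitional weighted manipulation\<close>

record ccwm_instance =
  ccwm_candidates :: nat
  ccwm_preferred :: nat
  ccwm_votes :: "(nat \<times> vote) list"
  ccwm_open_weights :: "nat list"

definition ccwm_valid :: "ccwm_instance \<Rightarrow> bool" where
  "ccwm_valid I \<longleftrightarrow>
     ccwm_preferred I < ccwm_candidates I \<and>
     (\<forall>(w, v) \<in> set (ccwm_votes I). v \<in> permutations_of_set {..<ccwm_candidates I})"

definition ccwm_yes :: "protocol \<Rightarrow> ccwm_instance \<Rightarrow> bool" where
  "ccwm_yes W I \<longleftrightarrow>
     (\<exists>vs. length vs = length (ccwm_open_weights I) \<and>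
           set vs \<subseteq> permutations_of_set {..<ccwm_candidates I} \<and>
           wins W (ccwm_candidates I) (ccwm_preferred I)
             (ccwm_votes I @ zip (ccwm_open_weights I) vs))"

definition ccwm_data :: "ccwm_instance \<Rightarrow> data" where
  "ccwm_data I = Lst
     [candidates_data (ccwm_candidates I),
      Num (ccwm_preferred I),
      Lst (map (\<lambda>(w, v). Lst [Num w, vote_data v]) (ccwm_votes I)),
      Lst (map Num (ccwm_open_weights I))]"

definition CCWM :: "protocol \<Rightarrow> ccwm_instance set \<Rightarrow> problem" where
  "CCWM W A =
     ((\<lambda>I. encode (ccwm_data I)) ` {I \<in> A. ccwm_valid I},
      (\<lambda>I. encode (ccwm_data I)) ` {I \<in> A. ccwm_valid I \<and> ccwm_yes W I})"


section \<open>Uncertain votes constructive weighted evaluation\<close>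

text \<open>
  A distribution over the profiles of votes is either an arbitrary one, given by an explicit
  table of profiles with rational probabilities, or a product of marginal distributions of
  the individual votes, given together with the weights of the voters.
\<close>

datatype marginal = Uniform | Point vote | Table "(vote \<times> rat) list"

datatype electorate =
    Independent "(nat \<times> marginal) list"
  | Joint "nat list" "(vote list \<times> rat) list"

record uvcwe_instance =
  uvcwe_candidates :: nat
  uvcwe_preferred :: nat
  uvcwe_threshold :: rat
  uvcwe_electorate :: electorate

definition real_table :: "('a \<times> rat) list \<Rightarrow> ('a \<times> real) list" where
  "real_table xs = map (\<lambda>(x, q). (x, real_of_rat q)) xs"

fun marginal_valid :: "nat \<Rightarrow> marginal \<Rightarrow> bool" where
  "marginal_valid m Uniform \<longleftrightarrow> True"
| "marginal_valid m (Point v) \<longleftrightarrow> v \<in> permutations_of_set {..<m}"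
| "marginal_valid m (Table xs) \<longleftrightarrow>
     pmf_of_list_wf (real_table xs) \<and> (\<forall>(v, q) \<in> set xs. v \<in> permutations_of_set {..<m})"

fun marginal_pmf :: "nat \<Rightarrow> marginal \<Rightarrow> vote pmf" where
  "marginal_pmf m Uniform = pmf_of_set (permutations_of_set {..<m})"
| "marginal_pmf m (Point v) = return_pmf v"
| "marginal_pmf m (Table xs) = pmf_of_list (real_table xs)"

fun electorate_valid :: "nat \<Rightarrow> electorate \<Rightarrow> bool" where
  "electorate_valid m (Independent vs) \<longleftrightarrow> (\<forall>(w, d) \<in> set vs. marginal_valid m d)"
| "electorate_valid m (Joint ws xs) \<longleftrightarrow>
     pmf_of_list_wf (real_table xs) \<and>
     (\<forall>(vs, q) \<in> set xs. length vs = length ws \<and> set vs \<subseteq> permutations_of_set {..<m})"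

fun weights :: "electorate \<Rightarrow> nat list" where
  "weights (Independent vs) = map fst vs"
| "weights (Joint ws xs) = ws"

fun profile_pmf :: "nat \<Rightarrow> electorate \<Rightarrow> vote list pmf" where
  "profile_pmf m (Independent vs) =
     map_pmf (\<lambda>f. map f [0..<length vs])
       (Pi_pmf {..<length vs} [] (\<lambda>i. marginal_pmf m (snd (vs ! i))))"
| "profile_pmf m (Joint ws xs) = pmf_of_list (real_table xs)"

definition uvcwe_valid :: "uvcwe_instance \<Rightarrow> bool" where
  "uvcwe_valid I \<longleftrightarrow>
     uvcwe_preferred I < uvcwe_candidates I \<and>
     0 \<le> uvcwe_threshold I \<and> uvcwe_threshold I \<le> 1 \<and>
     electorate_valid (uvcwe_candidates I) (uvcwe_electorate I)"

definition uvcwe_yes :: "protocol \<Rightarrow> uvcwe_instance \<Rightarrow> bool" where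
  "uvcwe_yes W I \<longleftrightarrow>
     measure_pmf.prob (profile_pmf (uvcwe_candidates I) (uvcwe_electorate I))
       {vs. wins W (uvcwe_candidates I) (uvcwe_preferred I)
              (zip (weights (uvcwe_electorate I)) vs)}
     > real_of_rat (uvcwe_threshold I)"

fun marginal_data :: "marginal \<Rightarrow> data" where
  "marginal_data Uniform = Lst [Num 0]"
| "marginal_data (Point v) = Lst [Num 1, vote_data v]"
| "marginal_data (Table xs) =
     Lst [Num 2, Lst (map (\<lambda>(v, q). Lst [vote_data v, rat_data q]) xs)]"

fun electorate_data :: "electorate \<Rightarrow> data" where
  "electorate_data (Independent vs) =
     Lst [Num 0, Lst (map (\<lambda>(w, d). Lst [Num w, marginal_data d]) vs)]"
| "electorate_data (Joint ws xs) =
     Lst [Num 1, Lst (map Num ws),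
       Lst (map (\<lambda>(vs, q). Lst [Lst (map vote_data vs), rat_data q]) xs)]"

definition uvcwe_data :: "uvcwe_instance \<Rightarrow> data" where
  "uvcwe_data I = Lst
     [candidates_data (uvcwe_candidates I),
      Num (uvcwe_preferred I),
      rat_data (uvcwe_threshold I),
      electorate_data (uvcwe_electorate I)]"

definition UVCWE :: "protocol \<Rightarrow> uvcwe_instance set \<Rightarrow> problem" where
  "UVCWE W A =
     ((\<lambda>I. encode (uvcwe_data I)) ` {I \<in> A. uvcwe_valid I},
      (\<lambda>I. encode (uvcwe_data I)) ` {I \<in> A. uvcwe_valid I \<and> uvcwe_yes W I})"

definition restricted_instances :: "uvcwe_instance set" where
  "restricted_instances =
     {I. \<exists>vs. uvcwe_electorate I = Independent vs \<and>
              (\<forall>(w, d) \<in> set vs. d = Uniform \<or> (\<exists>v. d = Point v))}"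

end

theory Submission
  imports Defs "HOL-Library.Countable"
begin

text \<open>
  Keep the weighted votes of a CCWM instance as point distributions, make the open votes uniform
  and ask for a probability greater than 0.  The support of the resulting product distribution
  consists of exactly the profiles the manipulators can bring about, so \<open>p\<close> wins with positive
  probability iff some manipulation succeeds.  On encodings this only inserts and deletes
  brackets and constants, at places that a finite automaton can recognise.
\<close>

section \<open>Composition of polynomial-time functions\<close>

text \<open>\<open>polytime\<close> is defined by concrete one-tape machines, so closure under
  composition and the running time of the reduction both have to be derived from machines. This is
  why the reduction is written as a letter-by-letter transducer: one generic machine runs any
  finite-state transducer in quadratic time, and only a finite table concerns elections. The
  threshold 0 fits this, being a constant word. The second obstacle is that problems are sets of
  words. A word produced by the reduction might also encode a different UVCWE instance with another
  answer, so the backward direction needs unique decodability. It is proved at the images of the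
  reduction only, because \<open>rat_data\<close> identifies some negative rationals with each other
  and with 0.\<close>

lemma poly_nat_mono:
  fixes b :: "nat poly"
  assumes "x \<le> y"
  shows "poly b x \<le> poly b y"
  using assms by (induction b) (auto intro: add_mono mult_le_mono)

section \<open>Growth of the nonblank part of a tape\<close>

definition nonblank :: "(int \<Rightarrow> nat) \<Rightarrow> int set" where
  "nonblank t = {i. t i \<noteq> 0}"

text \<open>A move translates the tape. Any map \<open>h\<close> serves, because an image never has
  more elements.\<close>

lemma nonblank_shift:
  "\<exists>h. nonblank (shift d t) = h ` nonblank t"
proof (cases d)
  case Move_Left
  then have "nonblank (shift d t) = (\<lambda>i. i + 1) ` nonblank t"
    by (force simp: nonblank_def image_iff intro: exI[of _ "_ - 1"])
  then show ?thesis by blast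
next
  case Move_Right
  then have "nonblank (shift d t) = (\<lambda>i. i - 1) ` nonblank t"
    by (force simp: nonblank_def image_iff intro: exI[of _ "_ + 1"])
  then show ?thesis by blast
next
  case Stay
  then have "nonblank (shift d t) = id ` nonblank t" by simp
  then show ?thesis by blast
qed

lemma nonblank_step:
  assumes "(c, c') \<in> step M" and fin: "finite (nonblank (snd c))"
  shows "finite (nonblank (snd c')) \<and> card (nonblank (snd c')) \<le> Suc (card (nonblank (snd c)))"
proof -
  obtain q t q' b d where c: "c = (q, t)" "c' = (q', shift d (t(0 := b)))"
    using assms(1) by (auto simp: step_def)
  obtain h where h: "nonblank (snd c') = h ` nonblank (t(0 := b))"
    using nonblank_shift c by fastforce
  have sub: "nonblank (t(0 := b)) \<subseteq> insert 0 (nonblank t)"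
    by (auto simp: nonblank_def)
  have fin': "finite (insert 0 (nonblank t))" using fin c by simp
  have "card (h ` nonblank (t(0 := b))) \<le> card (nonblank (t(0 := b)))"
    using card_image_le finite_subset[OF sub fin'] by blast
  also have "\<dots> \<le> card (insert 0 (nonblank t))" by (rule card_mono[OF fin' sub])
  also have "\<dots> \<le> Suc (card (nonblank t))" using fin c by (simp add: card_insert_if)
  finally show ?thesis using h finite_subset[OF sub fin'] c by simp
qed

lemma nonblank_relpow:
  assumes "(c, c') \<in> step M ^^ n" and "finite (nonblank (snd c))"
  shows "finite (nonblank (snd c')) \<and> card (nonblank (snd c')) \<le> card (nonblank (snd c)) + n"
  using assms
proof (induction n arbitrary: c')
  case (Suc n)
  then obtain d where "(c, d) \<in> step M ^^ n" "(d, c') \<in> step M" by auto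
  with Suc nonblank_step[of d c' M] show ?case by fastforce
qed simp

lemma nonblank_word_tape: "nonblank (word_tape w) = {0..<int (length w)}"
  by (auto simp: nonblank_def word_tape_def)

text \<open>A step fills at most one blank cell, and a clean final tape has one nonblank cell per
  output letter. In a composition this bounds the input of the second machine.\<close>

lemma output_length:
  assumes "((q, word_tape x), (q', word_tape y)) \<in> step M ^^ n"
  shows "length y \<le> length x + n"
  using nonblank_relpow[OF assms] by (simp add: nonblank_word_tape)

section \<open>Sequential composition of machines\<close>

definition rename :: "(nat \<Rightarrow> nat) \<Rightarrow> machine \<Rightarrow> machine" where
  "rename r M = (\<lambda>(q, a, q', b, d). (r q, a, r q', b, d)) ` M"

lemma mem_rename:
  "(p, a, p', b, d) \<in> rename r M \<longleftrightarrow> (\<exists>q q'. p = r q \<and> p' = r q' \<and> (q, a, q', b, d) \<in> M)"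
  unfolding rename_def by force

lemma turing_machine_source:
  assumes "turing_machine M" "(q, z) \<in> M"
  shows "q \<noteq> 1"
  using assms unfolding turing_machine_def by fast

lemma rename_source:
  assumes "turing_machine M" "(p, z) \<in> rename r M"
  obtains q where "p = r q" "q \<noteq> 1"
proof -
  obtain q y where "p = r q" "(q, y) \<in> M" using assms(2) unfolding rename_def by force
  with that turing_machine_source[OF assms(1)] show thesis by blast
qed

lemma step_rename:
  assumes "rename r M \<subseteq> M'" and "((q, t), (q', t')) \<in> step M ^^ n"
  shows "((r q, t), (r q', t')) \<in> step M' ^^ n"
  using assms(2)
proof (induction n arbitrary: q' t')
  case (Suc n)
  then obtain p s where ps: "((q, t), (p, s)) \<in> step M ^^ n" "((p, s), (q', t')) \<in> step M" by auto
  from ps(2) obtain b d where bd: "(p, s 0, q', b, d) \<in> M" "t' = shift d (s(0 := b))"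
    by (auto simp: step_def)
  then have "(r p, s 0, r q', b, d) \<in> rename r M" by (auto simp: mem_rename)
  then have "(r p, s 0, r q', b, d) \<in> M'" using assms(1) by blast
  with bd have "((r p, s), (r q', t')) \<in> step M'" by (auto simp: step_def)
  with Suc.IH[OF ps(1)] show ?case by auto
qed simp

lemma deterministic_rename:
  assumes "deterministic M" "inj r"
  shows "deterministic (rename r M)"
  unfolding deterministic_def
proof (intro allI impI)
  fix q a x y
  assume "(q, a, x) \<in> rename r M" "(q, a, y) \<in> rename r M"
  moreover obtain x1 x2 x3 y1 y2 y3 where xy: "x = (x1, x2, x3)" "y = (y1, y2, y3)"
    by (metis prod.exhaust)
  ultimately obtain p p' z z' where p: "q = r p" "x1 = r z" "(p, a, z, x2, x3) \<in> M"
    "q = r p'" "y1 = r z'" "(p', a, z', y2, y3) \<in> M"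
    unfolding xy mem_rename by blast
  have "p' = p" using p(1,4) assms(2) by (auto dest: injD)
  then have "(z, x2, x3) = (z', y2, y3)" using assms(1) p unfolding deterministic_def by blast
  then show "x = y" using p xy by simp
qed

text \<open>
  The two state sets are separated by parity; only the halting state of the first machine and
  the initial state of the second one are identified, as state 3.
\<close>

definition first_state :: "nat \<Rightarrow> nat" where
  "first_state q = (if q = 1 then 3 else 2 * q)"

definition second_state :: "nat \<Rightarrow> nat" where
  "second_state q = (if q = 0 then 3 else if q = 1 then 1 else 2 * q + 1)"

lemma inj_first_state: "inj first_state"
  unfolding inj_def first_state_def by presburger

lemma inj_second_state: "inj second_state"
  unfolding inj_def second_state_def by presburger

lemma first_state_source: "q \<noteq> 1 \<Longrightarrow> even (first_state q) \<and> first_state q \<noteq> 1"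
  unfolding first_state_def by presburger

lemma second_state_source: "q \<noteq> 1 \<Longrightarrow> odd (second_state q) \<and> second_state q \<noteq> 1"
  unfolding second_state_def by presburger

definition seq :: "machine \<Rightarrow> machine \<Rightarrow> machine" where
  "seq M N = rename first_state M \<union> rename second_state N"

lemma turing_machine_seq:
  assumes "turing_machine M" "turing_machine N"
  shows "turing_machine (seq M N)"
proof -
  have "q \<noteq> 1" if "(q, z) \<in> seq M N" for q z
    using that unfolding seq_def Un_iff
    by (elim disjE rename_source[OF assms(1)] rename_source[OF assms(2)])
      (use first_state_source second_state_source in \<open>simp_all only: not_False_eq_True\<close>)
  moreover have "finite (seq M N)"
    using assms by (simp add: seq_def turing_machine_def rename_def)
  ultimately show ?thesis unfolding turing_machine_def by blast
qed

text \<open>State 1 is never a source, so sources are even in the first copy and odd in the second,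
  and no rule of one competes with a rule of the other.\<close>

lemma deterministic_seq:
  assumes "turing_machine M" "turing_machine N" "deterministic M" "deterministic N"
  shows "deterministic (seq M N)"
proof -
  have "even q" if "(q, z) \<in> rename first_state M" for q z
    using rename_source[OF assms(1) that] first_state_source by metis
  moreover have "odd q" if "(q, z) \<in> rename second_state N" for q z
    using rename_source[OF assms(2) that] second_state_source by metis
  moreover have "deterministic (rename first_state M)" "deterministic (rename second_state N)"
    using assms by (simp_all add: deterministic_rename inj_first_state inj_second_state)
  ultimately show ?thesis
    unfolding seq_def deterministic_def by blast
qed

lemma polytime_comp:
  assumes "polytime f" "polytime g"
  shows "polytime (g \<circ> f)"
proof -
  obtain M b where M: "turing_machine M" "deterministic M"
    and b: "\<And>x. \<exists>n \<le> poly b (length x). ((0, word_tape x), (1, word_tape (f x))) \<in> step M ^^ n"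
    using assms(1) unfolding polytime_def by blast
  obtain N c where N: "turing_machine N" "deterministic N"
    and c: "\<And>x. \<exists>n \<le> poly c (length x). ((0, word_tape x), (1, word_tape (g x))) \<in> step N ^^ n"
    using assms(2) unfolding polytime_def by blast
  \<comment> \<open>The intermediate word has length at most n plus \<open>b\<close> at n, so
    \<open>c\<close> is evaluated there; \<open>[:0, 1:]\<close> is the identity polynomial.\<close>
  let ?bound = "b + pcompose c ([:0, 1:] + b)"
  have "\<exists>n \<le> poly ?bound (length x).
      ((0, word_tape x), (1, word_tape ((g \<circ> f) x))) \<in> step (seq M N) ^^ n" for x
  proof -
    obtain m where m: "m \<le> poly b (length x)"
      "((0, word_tape x), (1, word_tape (f x))) \<in> step M ^^ m" using b by blast
    obtain n where n: "n \<le> poly c (length (f x))"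
      "((0, word_tape (f x)), (1, word_tape (g (f x)))) \<in> step N ^^ n" using c by blast
    have "length (f x) \<le> length x + poly b (length x)"
      using output_length[OF m(2)] m(1) by simp
    then have "n \<le> poly c (length x + poly b (length x))"
      using n(1) poly_nat_mono le_trans by blast
    then have "m + n \<le> poly ?bound (length x)"
      using m(1) by (simp add: poly_pcompose)
    \<comment> \<open>The clean output tape is already an input tape and state 3 belongs to both
      copies, so the hand-over costs no step.\<close>
    moreover have "((0, word_tape x), (3, word_tape (f x))) \<in> step (seq M N) ^^ m"
      using step_rename[OF _ m(2), of first_state "seq M N"]
      by (simp add: seq_def first_state_def)
    moreover have "((3, word_tape (f x)), (1, word_tape (g (f x)))) \<in> step (seq M N) ^^ n"
      using step_rename[OF _ n(2), of second_state "seq M N"]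
      by (simp add: seq_def second_state_def)
    ultimately show ?thesis
      unfolding comp_apply by (intro exI[of _ "m + n"]) (auto simp: relpow_add)
  qed
  then show ?thesis
    unfolding polytime_def
    using turing_machine_seq[OF M(1) N(1)] deterministic_seq[OF M(1) N(1) M(2) N(2)] by blast
qed

lemma poly_reducible_trans:
  assumes "poly_reducible P Q" "poly_reducible Q R"
  shows "poly_reducible P R"
proof -
  obtain f where f: "polytime f" "\<And>x. x \<in> fst P \<Longrightarrow> f x \<in> fst Q \<and> (x \<in> snd P \<longleftrightarrow> f x \<in> snd Q)"
    using assms(1) unfolding poly_reducible_def by blast
  obtain g where g: "polytime g" "\<And>x. x \<in> fst Q \<Longrightarrow> g x \<in> fst R \<and> (x \<in> snd Q \<longleftrightarrow> g x \<in> snd R)"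
    using assms(2) unfolding poly_reducible_def by blast
  show ?thesis
    unfolding poly_reducible_def using polytime_comp[OF f(1) g(1)] f(2) g(2)
    by (intro exI[of _ "g \<circ> f"]) auto
qed

lemma NP_hard_reduction:
  assumes "NP_hard P" "poly_reducible P Q"
  shows "NP_hard Q"
  using assms poly_reducible_trans unfolding NP_hard_def by blast


section \<open>Finite-state transducers\<close>

fun transduce :: "('q \<Rightarrow> bool \<Rightarrow> 'q \<times> bool list) \<Rightarrow> 'q \<Rightarrow> bool list \<Rightarrow> 'q \<times> bool list" where
  "transduce \<delta> q [] = (q, [])"
| "transduce \<delta> q (b # bs) =
     (let (q', y) = \<delta> q b; (q'', ys) = transduce \<delta> q' bs in (q'', y @ ys))"

lemma transduce_append:
  assumes "transduce \<delta> q xs = (q', us)" "transduce \<delta> q' ys = (q'', vs)"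
  shows "transduce \<delta> q (xs @ ys) = (q'', us @ vs)"
  using assms by (induction xs arbitrary: q us) (auto split: prod.splits)

lemma transduce_concat:
  assumes "\<And>x. x \<in> set xs \<Longrightarrow> transduce \<delta> q (f x) = (q, g x)"
  shows "transduce \<delta> q (concat (map f xs)) = (q, concat (map g xs))"
  using assms by (induction xs) (auto intro: transduce_append)

text \<open>A tape as a zipper: the cells left of the head, nearest first, and those from the head on.\<close>

definition tape :: "nat list \<Rightarrow> nat list \<Rightarrow> int \<Rightarrow> nat" where
  "tape l r i = (if 0 \<le> i then nth_default 0 r (nat i) else nth_default 0 l (nat (- i - 1)))"

definition scanned :: "nat list \<Rightarrow> nat" where
  "scanned r = nth_default 0 r 0"

lemma scanned_simps [simp]: "scanned [] = 0" "scanned (a # r) = a"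
  by (simp_all add: scanned_def)

lemma tape_0 [simp]: "tape l r 0 = scanned r"
  by (simp add: tape_def scanned_def)

lemma nth_default_Cons_pos: "0 < n \<Longrightarrow> nth_default x (y # ys) n = nth_default x ys (n - 1)"
  by (cases n) simp_all

lemma nth_default_tl: "nth_default x (tl ys) n = nth_default x ys (Suc n)"
  by (cases ys) simp_all

lemma shift_right_tape:
  "shift Move_Right ((tape l r)(0 := b)) = tape (b # l) (tl r)"
  by (rule ext)
    (auto simp: tape_def nth_default_tl nth_default_Cons_pos nat_add_distrib
       intro!: arg_cong[of _ _ "nth_default 0 l"])

lemma shift_left_tape:
  "shift Move_Left ((tape l r)(0 := b)) = tape (tl l) (scanned l # b # tl r)"
proof
  fix i :: int
  consider "i < 0" | "i = 0" | "i = 1" | "1 < i" by linarith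
  then show "shift Move_Left ((tape l r)(0 := b)) i = tape (tl l) (scanned l # b # tl r) i"
  proof cases
    case 1
    then have "nat (- (i - 1) - 1) = Suc (nat (- i - 1))" by simp
    with 1 show ?thesis by (simp add: tape_def nth_default_tl)
  next
    case 4
    then have "nat (i - 1) = Suc (nat i - 2)" by simp
    with 4 show ?thesis by (simp add: tape_def nth_default_tl nth_default_Cons_pos numeral_2_eq_2)
  qed (simp_all add: tape_def scanned_def)
qed

lemma write_scanned_tape: "(tape l r)(0 := scanned r) = tape l r"
  by (metis fun_upd_triv tape_0)

text \<open>A tape has many list representations, since cells beyond a list are blank. The rules for
  the two ends drop the blanks that the head leaves there.\<close>

lemma tape_left_blank [simp]: "tape [0] r = tape [] r"
  by (rule ext) (simp add: tape_def nth_default_def)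

lemma tape_right_blank [simp]: "tape l (r @ [0]) = tape l r"
  by (rule ext) (auto simp: tape_def nth_default_def nth_append)

definition input_symbol :: "bool \<Rightarrow> nat" where
  "input_symbol b = (if b then 2 else 1)"

definition output_symbol :: "bool \<Rightarrow> nat" where
  "output_symbol b = (if b then 4 else 3)"

lemma word_tape_eq: "word_tape w = tape [] (map input_symbol w)"
  by (rule ext) (auto simp: word_tape_def tape_def nth_default_def input_symbol_def)

text \<open>
  The machine removes the leftmost input letter, carries the output it produces to the right end
  of the tape, and returns.  Output letters are kept apart from the input as symbols 3 and 4;
  once no input is left they are converted to 1 and 2.  \<open>Return None\<close> is the final return.
\<close>

datatype 'q phase =
  Halt | Read 'q | Carry 'q "bool list" | Convert | Return "'q option"

instance phase :: (countable) countable
  by countable_datatype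

text \<open>The nonblank cells always form one block, so the first blank met in either direction is
  its end. For \<open>Read\<close>, a blank or an output symbol means that the input is used
  up.\<close>

fun program ::
  "('q \<Rightarrow> bool \<Rightarrow> 'q \<times> bool list) \<Rightarrow> 'q phase \<Rightarrow> nat \<Rightarrow> ('q phase \<times> nat \<times> move) option" where
  "program \<delta> Halt a = None"
| "program \<delta> (Read q) a =
     (if a = 1 \<or> a = 2
      then Some (Carry (fst (\<delta> q (a = 2))) (snd (\<delta> q (a = 2))), 0, Move_Right)
      else Some (Convert, a, Stay))"
| "program \<delta> (Carry q ys) a =
     (if a \<noteq> 0 then Some (Carry q ys, a, Move_Right)
      else case ys of
        [] \<Rightarrow> Some (Return (Some q), 0, Move_Left)
      | y # ys' \<Rightarrow> Some (Carry q ys', output_symbol y, Move_Right))"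
| "program \<delta> Convert a =
     (if a = 0 then Some (Return None, 0, Move_Left)
      else Some (Convert, input_symbol (a = 4), Move_Right))"
| "program \<delta> (Return r) a =
     (if a \<noteq> 0 then Some (Return r, a, Move_Left)
      else case r of
        None \<Rightarrow> Some (Halt, 0, Move_Right)
      | Some q \<Rightarrow> Some (Read q, 0, Move_Right))"

section \<open>A finite machine for a given transducer\<close>

context
  fixes \<delta> :: "'q :: finite \<Rightarrow> bool \<Rightarrow> 'q \<times> bool list" and q0 :: 'q
begin

definition max_output :: nat where
  "max_output = Max (range (\<lambda>(q, b). length (snd (\<delta> q b))))"

lemma length_output: "length (snd (\<delta> q b)) \<le> max_output"
  unfolding max_output_def by (rule Max_ge) (auto intro: range_eqI[of _ _ "(q, b)"])

text \<open>\<open>Carry\<close> holds a word, so the type of phases is infinite; bounding the word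
  by the longest single output leaves finitely many.\<close>

definition phases :: "'q phase set" where
  "phases = {s. \<forall>q ys. s = Carry q ys \<longrightarrow> length ys \<le> max_output}"

lemma finite_phases: "finite phases"
proof -
  have "phases \<subseteq> {Halt, Convert} \<union> range Read \<union> range Return
      \<union> case_prod Carry ` (UNIV \<times> {ys. set ys \<subseteq> UNIV \<and> length ys \<le> max_output})"
  proof
    fix s assume "s \<in> phases"
    then show "s \<in> {Halt, Convert} \<union> range Read \<union> range Return
      \<union> case_prod Carry ` (UNIV \<times> {ys. set ys \<subseteq> UNIV \<and> length ys \<le> max_output})"
      by (cases s) (auto simp: phases_def)
  qed
  moreover have "finite {ys :: bool list. set ys \<subseteq> UNIV \<and> length ys \<le> max_output}"
    by (rule finite_lists_length_le) simp
  ultimately show ?thesis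
    by (elim finite_subset) (intro finite_UnI finite_imageI finite_cartesian_product; simp)
qed

text \<open>The machine model reserves 0 for the initial and 1 for the halting state; adding 2 keeps
  all other phases away from them.\<close>

definition code :: "'q phase \<Rightarrow> nat" where
  "code s = (if s = Read q0 then 0 else if s = Halt then 1 else to_nat s + 2)"

lemma code_eq_iff: "code s = code s' \<longleftrightarrow> s = s'"
  by (auto simp: code_def)

text \<open>The symbols below 5 are the blank, two input symbols and two output symbols.\<close>

definition transducer_machine :: machine where
  "transducer_machine = {(code s, a, code s', b, d) | s a s' b d.
     s \<in> phases \<and> a < 5 \<and> program \<delta> s a = Some (s', b, d)}"

lemma turing_machine_transducer: "turing_machine transducer_machine"
proof -
  have "transducer_machine \<subseteq>
      (\<lambda>(s, a). case the (program \<delta> s a) of (s', b, d) \<Rightarrow> (code s, a, code s', b, d))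
        ` (phases \<times> {..<5})"
    unfolding transducer_machine_def by (force simp: image_iff)
  then have "finite transducer_machine"
    using finite_phases by (elim finite_subset) simp
  moreover have "q \<noteq> 1" if "(q, z) \<in> transducer_machine" for q z
    using that unfolding transducer_machine_def by (auto simp: code_def split: if_splits)
  ultimately show ?thesis unfolding turing_machine_def by blast
qed

lemma deterministic_transducer: "deterministic transducer_machine"
  unfolding deterministic_def transducer_machine_def by (auto simp: code_eq_iff)

section \<open>Runs of the transducer machine and their lengths\<close>

definition run :: "nat \<Rightarrow> 'q phase \<Rightarrow> (int \<Rightarrow> nat) \<Rightarrow> 'q phase \<Rightarrow> (int \<Rightarrow> nat) \<Rightarrow> bool" where
  "run n s t s' t' \<longleftrightarrow> ((code s, t), (code s', t')) \<in> step transducer_machine ^^ n"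

lemma run_0: "run 0 s t s t"
  by (simp add: run_def)

lemma run_trans: "run m s t s' t' \<Longrightarrow> run n s' t' s'' t'' \<Longrightarrow> run (m + n) s t s'' t''"
  by (auto simp: run_def relpow_add)

lemma run_step:
  assumes "program \<delta> s (scanned r) = Some (s', b, d)" "s \<in> phases" "scanned r < 5"
  shows "run 1 s (tape l r) s' (shift d ((tape l r)(0 := b)))"
  using assms by (force simp: run_def step_def transducer_machine_def)

lemma run_Suc: "run 1 s t s' t' \<Longrightarrow> run n s' t' s'' t'' \<Longrightarrow> run (Suc n) s t s'' t''"
  using run_trans[of 1] by simp

lemma run_carry_right:
  assumes "\<forall>a \<in> set r. 0 < a \<and> a < 5" "length ys \<le> max_output"
  shows "run (length r) (Carry q ys) (tape l r) (Carry q ys) (tape (rev r @ l) [])"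
  using assms(1)
proof (induction r arbitrary: l)
  case (Cons a r)
  have "run 1 (Carry q ys) (tape l (a # r)) (Carry q ys) (tape (a # l) r)"
    using run_step[of "Carry q ys" "a # r" "Carry q ys" a Move_Right l] Cons.prems assms(2)
    by (simp only: shift_right_tape) (simp add: phases_def)
  from run_Suc[OF this Cons.IH] Cons.prems show ?case by simp
qed (simp add: run_0)

lemma run_carry_write:
  assumes "length ys \<le> max_output"
  shows "run (length ys) (Carry q ys) (tape l [])
    (Carry q []) (tape (rev (map output_symbol ys) @ l) [])"
  using assms
proof (induction ys arbitrary: l)
  case (Cons y ys)
  have "run 1 (Carry q (y # ys)) (tape l []) (Carry q ys) (tape (output_symbol y # l) [])"
    using run_step[of "Carry q (y # ys)" "[]" "Carry q ys" "output_symbol y" Move_Right l] Cons.prems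
    by (simp only: shift_right_tape) (simp add: phases_def)
  from run_Suc[OF this Cons.IH] Cons.prems show ?case by simp
qed (simp add: run_0)

lemma run_convert:
  "run (length v) Convert (tape l (map output_symbol v))
    Convert (tape (rev (map input_symbol v) @ l) [])"
proof (induction v arbitrary: l)
  case (Cons y v)
  have "run 1 Convert (tape l (map output_symbol (y # v))) Convert
      (tape (input_symbol y # l) (map output_symbol v))"
    using run_step[of Convert "map output_symbol (y # v)" Convert "input_symbol y" Move_Right l]
    by (simp only: shift_right_tape) (simp add: phases_def output_symbol_def)
  from run_Suc[OF this Cons.IH] show ?case by simp
qed (simp add: run_0)

text \<open>The head starts on the first entry of \<open>l\<close>, hence the form of the tape. For
  empty \<open>l\<close> it is already on the blank left of the block, as \<open>scanned []\<close>
  is 0, and no step is made.\<close>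

lemma run_return:
  assumes "\<forall>a \<in> set l. 0 < a \<and> a < 5"
  shows "run (length l) (Return z) (tape (tl l) (scanned l # r)) (Return z) (tape [] (0 # rev l @ r))"
  using assms
proof (induction l arbitrary: r)
  case (Cons a l)
  have "run 1 (Return z) (tape l (a # r)) (Return z) (tape (tl l) (scanned l # a # r))"
    using run_step[of "Return z" "a # r" "Return z" a Move_Left l] Cons.prems
    by (simp only: shift_left_tape) (simp add: phases_def)
  from run_Suc[OF this Cons.IH] Cons.prems show ?case by simp
qed (simp add: run_0)

text \<open>Both return trips, to the next \<open>Read\<close> and to \<open>Halt\<close>, are
  instances. The 2 counts the turn at the right-hand blank and the step off the left-hand
  blank.\<close>

lemma run_turn_return:
  assumes "\<forall>a \<in> set r. 0 < a \<and> a < 5"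
    and turn: "program \<delta> s 0 = Some (Return z, 0, Move_Left)" "s \<in> phases"
    and stop: "program \<delta> (Return z) 0 = Some (s', 0, Move_Right)"
  shows "run (length r + 2) s (tape (rev r) []) s' (tape [] r)"
proof -
  have "run 1 s (tape (rev r) []) (Return z) (tape (tl (rev r)) (scanned (rev r) # [0]))"
    using run_step[of s "[]" "Return z" 0 Move_Left "rev r"] turn
    by (simp only: shift_left_tape) simp
  moreover have "run (length r) (Return z) (tape (tl (rev r)) (scanned (rev r) # [0]))
      (Return z) (tape [] (0 # r @ [0]))"
    using run_return[of "rev r" z "[0]"] assms(1) by simp
  moreover have "run 1 (Return z) (tape [] (0 # r @ [0])) s' (tape [] r)"
    using run_step[of "Return z" "0 # r @ [0]" s' 0 Move_Right "[]"] stop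
    by (simp only: shift_right_tape) (simp add: phases_def)
  ultimately have "run (1 + length r + 1) s (tape (rev r) []) s' (tape [] r)"
    using run_trans by blast
  also have "1 + length r + 1 = length r + 2" by simp
  finally show ?thesis .
qed

lemma symbols:
  "\<forall>a \<in> set (map input_symbol u @ map output_symbol v). 0 < a \<and> a < 5"
  by (auto simp: input_symbol_def output_symbol_def)

text \<open>One round: 1 step erases the letter, \<open>length u + length v\<close> steps cross the
  rest, \<open>length ys\<close> steps write, and \<open>run_turn_return\<close> leads back.\<close>

lemma run_letter:
  assumes "\<delta> q b = (q', ys)"
  shows "run (2 * (length u + length v + length ys) + 3)
    (Read q) (tape [] (map input_symbol (b # u) @ map output_symbol v))
    (Read q') (tape [] (map input_symbol u @ map output_symbol (v @ ys)))"
proof -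
  let ?r = "map input_symbol u @ map output_symbol v"
  let ?r' = "map input_symbol u @ map output_symbol (v @ ys)"
  have ys: "length ys \<le> max_output" using length_output[of q b] assms by simp
  have "run 1 (Read q) (tape [] (map input_symbol (b # u) @ map output_symbol v))
      (Carry q' ys) (tape [] ?r)"
    using run_step[of "Read q" "input_symbol b # ?r" "Carry q' ys" 0 Move_Right "[]"] assms
    by (simp only: shift_right_tape) (auto simp: phases_def input_symbol_def split: if_splits)
  moreover have "run (length u + length v) (Carry q' ys) (tape [] ?r) (Carry q' ys) (tape (rev ?r) [])"
    using run_carry_right[OF symbols[of u v] ys, of q' "[]"] by simp
  moreover have "run (length ys) (Carry q' ys) (tape (rev ?r) []) (Carry q' []) (tape (rev ?r') [])"
    using run_carry_write[OF ys, of q' "rev ?r"] by simp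
  moreover have "run (length u + length v + length ys + 2)
      (Carry q' []) (tape (rev ?r') []) (Read q') (tape [] ?r')"
    using run_turn_return[OF symbols[of u "v @ ys"], of "Carry q' []" "Some q'" "Read q'"]
    by (simp add: phases_def add.assoc)
  ultimately have "run (1 + (length u + length v) + length ys + (length u + length v + length ys + 2))
      (Read q) (tape [] (map input_symbol (b # u) @ map output_symbol v)) (Read q') (tape [] ?r')"
    using run_trans by blast
  also have "1 + (length u + length v) + length ys + (length u + length v + length ys + 2)
      = 2 * (length u + length v + length ys) + 3" by simp
  finally show ?thesis .
qed

lemma run_finish:
  "run (2 * length v + 3) (Read q) (tape [] (map output_symbol v)) Halt (word_tape v)"
proof -
  let ?r = "map output_symbol v"
  \<comment> \<open>No input symbol is scanned: the cell is blank if \<open>v\<close> is empty and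
    holds an output symbol otherwise.\<close>
  have "scanned ?r \<in> {0, 3, 4}" by (cases v) (auto simp: output_symbol_def)
  then have "run 1 (Read q) (tape [] ?r) Convert (tape [] ?r)"
    using run_step[of "Read q" ?r Convert "scanned ?r" Stay "[]"] write_scanned_tape[of "[]" ?r]
    by (auto simp: phases_def)
  moreover have "run (length v) Convert (tape [] ?r) Convert (tape (rev (map input_symbol v)) [])"
    using run_convert[of v "[]"] by simp
  moreover have "run (length v + 2) Convert (tape (rev (map input_symbol v)) []) Halt (word_tape v)"
    using run_turn_return[of "map input_symbol v" Convert None Halt] symbols[of v "[]"]
    by (simp add: phases_def word_tape_eq)
  ultimately have "run (1 + length v + (length v + 2)) (Read q) (tape [] ?r) Halt (word_tape v)"
    using run_trans by blast
  also have "1 + length v + (length v + 2) = 2 * length v + 3" by simp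
  finally show ?thesis .
qed

text \<open>The left side of the assumption is a potential: a round takes one letter from
  \<open>u\<close> and adds at most \<open>max_output\<close> letters to \<open>v\<close>. So
  \<open>B\<close> bounds the word on the tape throughout, and each round, like the final
  conversion, costs at most \<open>2 * B + 3\<close>.\<close>

lemma run_transduce:
  assumes "length v + Suc max_output * length u \<le> B"
  shows "\<exists>n \<le> Suc (length u) * (2 * B + 3).
    run n (Read q) (tape [] (map input_symbol u @ map output_symbol v))
      Halt (word_tape (v @ snd (transduce \<delta> q u)))"
  using assms
proof (induction u arbitrary: q v)
  case Nil
  then show ?case using run_finish[of v q] by (auto intro!: exI[of _ "2 * length v + 3"])
next
  case (Cons b u)
  obtain q' ys where qy: "\<delta> q b = (q', ys)" by fastforce
  have ys: "length ys \<le> max_output" using length_output[of q b] qy by simp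
  with Cons.prems have "length (v @ ys) + Suc max_output * length u \<le> B" by simp
  from Cons.IH[OF this] obtain n where n: "n \<le> Suc (length u) * (2 * B + 3)"
    "run n (Read q') (tape [] (map input_symbol u @ map output_symbol (v @ ys)))
      Halt (word_tape ((v @ ys) @ snd (transduce \<delta> q' u)))" by blast
  let ?m = "2 * (length u + length v + length ys) + 3"
  have "length u + length v + length ys \<le> B" using Cons.prems ys by simp
  then have "?m + n \<le> Suc (length (b # u)) * (2 * B + 3)" using n(1) by simp
  moreover have "(v @ ys) @ snd (transduce \<delta> q' u) = v @ snd (transduce \<delta> q (b # u))"
    using qy by (simp split: prod.splits)
  ultimately show ?case using run_trans[OF run_letter[OF qy] n(2)] by metis
qed

lemma polytime_transduce: "polytime (\<lambda>x. snd (transduce \<delta> q0 x))"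
proof -
  let ?K = "Suc max_output"
  \<comment> \<open>For input length n this is the number \<open>n + 1\<close> of rounds times
    \<open>2 * B + 3\<close>, where \<open>B = ?K * n\<close>.\<close>
  let ?bound = "[:1, 1:] * [:3, 2 * ?K:] :: nat poly"
  have "\<exists>n \<le> poly ?bound (length x). ((0, word_tape x),
      (1, word_tape (snd (transduce \<delta> q0 x)))) \<in> step transducer_machine ^^ n" for x
  proof -
    have bound: "poly ?bound (length x) = Suc (length x) * (2 * (?K * length x) + 3)"
      by (simp only: poly_mult poly_pCons poly_0) (simp add: algebra_simps)
    show ?thesis
      using run_transduce[of "[]" x "?K * length x" q0]
      unfolding bound by (simp add: run_def code_def word_tape_eq)
  qed
  then show ?thesis
    unfolding polytime_def using turing_machine_transducer deterministic_transducer by blast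
qed

end


section \<open>The reduction as a transducer\<close>

text \<open>The format bounds the nesting depth, so finitely many locations replace a stack for
  matching brackets.\<close>

datatype location =
  Before | Before_Candidates | In_Candidates | In_Candidate | Before_Preferred | In_Preferred |
  Before_Votes | In_Votes | Before_Weight | In_Weight | Before_Vote | In_Vote | In_Rank |
  After_Vote | Before_Open | In_Open | In_Open_Weight | Done

instance location :: finite
proof
  have "(UNIV :: location set) \<subseteq> {Before, Before_Candidates, In_Candidates, In_Candidate,
    Before_Preferred, In_Preferred, Before_Votes, In_Votes, Before_Weight, In_Weight, Before_Vote,
    In_Vote, In_Rank, After_Vote, Before_Open, In_Open, In_Open_Weight, Done}"
    by (rule subsetI, case_tac x) simp_all
  then show "finite (UNIV :: location set)" by (rule finite_subset) simp
qed

abbreviation open_code :: "bool list" where "open_code \<equiv> [True, False]"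
abbreviation close_code :: "bool list" where "close_code \<equiv> [True, True]"
abbreviation digits :: "nat \<Rightarrow> bool list" where
  "digits n \<equiv> concat (map (\<lambda>d. [False, d]) (binary n))"

text \<open>
  The location tells which part of a CCWM encoding the next letter belongs to; digits are copied
  everywhere.  The second component of a state of \<open>reduction\<close> is the first bit of a half-read letter.
\<close>

fun on_opening :: "location \<Rightarrow> location \<times> bool list" where
  "on_opening Before = (Before_Candidates, open_code)"
| "on_opening Before_Candidates = (In_Candidates, open_code)"
| "on_opening In_Candidates = (In_Candidate, open_code)"
| "on_opening Before_Preferred = (In_Preferred, open_code)"
| "on_opening Before_Votes =
     (In_Votes, encode (rat_data 0) @ open_code @ encode (Num 0) @ open_code)"
| "on_opening In_Votes = (Before_Weight, open_code)"
| "on_opening Before_Weight = (In_Weight, open_code)"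
| "on_opening Before_Vote = (In_Vote, open_code @ encode (Num 1) @ open_code)"
| "on_opening In_Vote = (In_Rank, open_code)"
| "on_opening Before_Open = (In_Open, [])"
| "on_opening In_Open = (In_Open_Weight, open_code @ open_code)"
| "on_opening q = (q, [])"

text \<open>Nothing is written between the fixed and the open votes, which merges two lists into one
  list of voters. The second bracket at \<open>In_Vote\<close> closes the marginal opened at
  \<open>Before_Vote\<close>, the one at \<open>In_Open\<close> closes the electorate opened at
  \<open>Before_Votes\<close>.\<close>

fun on_closing :: "location \<Rightarrow> location \<times> bool list" where
  "on_closing In_Candidate = (In_Candidates, close_code)"
| "on_closing In_Candidates = (Before_Preferred, close_code)"
| "on_closing In_Preferred = (Before_Votes, close_code)"
| "on_closing In_Weight = (Before_Vote, close_code)"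
| "on_closing In_Rank = (In_Vote, close_code)"
| "on_closing In_Vote = (After_Vote, close_code @ close_code)"
| "on_closing After_Vote = (In_Votes, close_code)"
| "on_closing In_Votes = (Before_Open, [])"
| "on_closing In_Open_Weight = (In_Open, close_code @ encode (marginal_data Uniform) @ close_code)"
| "on_closing In_Open = (Done, close_code @ close_code)"
| "on_closing q = (q, close_code)"

fun reduction :: "location \<times> bool option \<Rightarrow> bool \<Rightarrow> (location \<times> bool option) \<times> bool list" where
  "reduction (q, None) b = ((q, Some b), [])"
| "reduction (q, Some False) b = ((q, None), [False, b])"
| "reduction (q, Some True) b =
     (let (q', y) = (if b then on_closing q else on_opening q) in ((q', None), y))"

definition reads :: "location \<Rightarrow> bool list \<Rightarrow> location \<Rightarrow> bool list \<Rightarrow> bool" where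
  "reads q x q' y \<longleftrightarrow> transduce reduction (q, None) x = ((q', None), y)"

lemma reads_append: "reads q x q' u \<Longrightarrow> reads q' y q'' v \<Longrightarrow> reads q (x @ y) q'' (u @ v)"
  unfolding reads_def by (rule transduce_append)

lemma reads_opening: "on_opening q = (q', y) \<Longrightarrow> reads q open_code q' y"
  by (simp add: reads_def)

lemma reads_closing: "on_closing q = (q', y) \<Longrightarrow> reads q close_code q' y"
  by (simp add: reads_def)

lemma reads_concat:
  assumes "\<And>x. x \<in> set xs \<Longrightarrow> reads q (f x) q (g x)"
  shows "reads q (concat (map f xs)) q (concat (map g xs))"
  using assms unfolding reads_def by (rule transduce_concat)

lemma reads_digits: "reads q (digits n) q (digits n)"
  by (rule reads_concat) (simp add: reads_def)

lemma reads_Num: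
  assumes "on_opening q = (q', y)" "on_closing q' = (q'', z)"
  shows "reads q (encode (Num n)) q'' (y @ digits n @ z)"
  unfolding encode.simps
  by (rule reads_append[OF reads_opening[OF assms(1)] reads_append[OF reads_digits reads_closing[OF assms(2)]]])

lemma reads_Lst:
  assumes "on_opening q = (q', y)" "on_closing q' = (q'', z)"
    and "\<And>x. x \<in> set xs \<Longrightarrow> reads q' (encode (f x)) q' (g x)"
  shows "reads q (encode (Lst (map f xs))) q'' (y @ concat (map g xs) @ z)"
  unfolding encode.simps map_map comp_def
  by (rule reads_append[OF reads_opening[OF assms(1)]
        reads_append[OF reads_concat[OF assms(3)] reads_closing[OF assms(2)]]])

text \<open>The fixed votes precede the open ones exactly as in \<open>ccwm_yes\<close>; the order
  matters because a protocol may depend on it.\<close>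

definition uvcwe_of_ccwm :: "ccwm_instance \<Rightarrow> uvcwe_instance" where
  "uvcwe_of_ccwm I = \<lparr>
     uvcwe_candidates = ccwm_candidates I,
     uvcwe_preferred = ccwm_preferred I,
     uvcwe_threshold = 0,
     uvcwe_electorate = Independent
       (map (\<lambda>(w, v). (w, Point v)) (ccwm_votes I) @ map (\<lambda>w. (w, Uniform)) (ccwm_open_weights I))\<rparr>"

lemma reads_candidates:
  "reads Before_Candidates (encode (candidates_data m)) Before_Preferred (encode (candidates_data m))"
proof -
  have "reads In_Candidates (encode (Num n)) In_Candidates (encode (Num n))" for n
    using reads_Num[of In_Candidates _ _ _ _ n] by simp
  then have "reads Before_Candidates (encode (candidates_data m)) Before_Preferred
      (open_code @ concat (map (\<lambda>n. encode (Num n)) [0..<m]) @ close_code)"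
    unfolding candidates_data_def by (intro reads_Lst[where q' = In_Candidates]) simp_all
  then show ?thesis by (simp add: candidates_data_def comp_def)
qed

lemma reads_vote:
  "reads Before_Vote (encode (vote_data v)) After_Vote (encode (marginal_data (Point v)))"
proof -
  have "reads In_Vote (encode (Num n)) In_Vote (encode (Num n))" for n
    using reads_Num[of In_Vote _ _ _ _ n] by simp
  then have "reads Before_Vote (encode (vote_data v)) After_Vote
     ((open_code @ encode (Num 1) @ open_code)
        @ concat (map (\<lambda>n. encode (Num n)) v) @ close_code @ close_code)"
    unfolding vote_data_def by (intro reads_Lst[where q' = In_Vote]) simp_all
  then show ?thesis by (simp add: vote_data_def comp_def)
qed

lemma reads_weighted_vote:
  "reads In_Votes (encode (Lst [Num w, vote_data v]))
     In_Votes (encode (Lst [Num w, marginal_data (Point v)]))"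
proof -
  have opened: "reads In_Votes open_code Before_Weight open_code"
    by (rule reads_opening) simp
  have weight: "reads Before_Weight (encode (Num w)) Before_Vote (encode (Num w))"
    using reads_Num[of Before_Weight _ _ _ _ w] by simp
  have closed: "reads After_Vote close_code In_Votes close_code"
    by (rule reads_closing) simp
  show ?thesis
    using reads_append[OF opened reads_append[OF weight reads_append[OF reads_vote[of v] closed]]]
    by (simp del: marginal_data.simps)
qed

lemma reads_open_weight:
  "reads In_Open (encode (Num w)) In_Open (encode (Lst [Num w, marginal_data Uniform]))"
  using reads_Num[of In_Open _ _ _ _ w] by simp

lemma reads_instance:
  "reads Before (encode (ccwm_data I)) Done (encode (uvcwe_data (uvcwe_of_ccwm I)))"
proof -
  let ?C = "encode (candidates_data (ccwm_candidates I))"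
  let ?P = "encode (Num (ccwm_preferred I))"
  let ?S = "Lst (map (\<lambda>(w, v). Lst [Num w, vote_data v]) (ccwm_votes I))"
  let ?T = "Lst (map Num (ccwm_open_weights I))"
  let ?f = "\<lambda>x. encode (Lst [Num (fst x), marginal_data (Point (snd x))])"
  let ?g = "\<lambda>w. encode (Lst [Num w, marginal_data Uniform])"
  have P: "reads Before_Preferred ?P Before_Votes ?P"
    using reads_Num[of Before_Preferred _ _ _ _ "ccwm_preferred I"] by simp
  have S: "reads Before_Votes (encode ?S) Before_Open
      ((encode (rat_data 0) @ open_code @ encode (Num 0) @ open_code)
        @ concat (map ?f (ccwm_votes I)) @ [])"
    by (rule reads_Lst) (use reads_weighted_vote in \<open>auto simp del: encode.simps\<close>)
  have T: "reads Before_Open (encode ?T) Done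
      ([] @ concat (map ?g (ccwm_open_weights I)) @ close_code @ close_code)"
    by (rule reads_Lst) (use reads_open_weight in \<open>auto simp del: encode.simps\<close>)
  have opened: "reads Before open_code Before_Candidates open_code"
    by (rule reads_opening) simp
  have closed: "reads Done close_code Done close_code"
    by (rule reads_closing) simp
  show ?thesis
    using reads_append[OF opened reads_append[OF reads_candidates[of "ccwm_candidates I"]
          reads_append[OF P reads_append[OF S reads_append[OF T closed]]]]]
    by (simp add: ccwm_data_def uvcwe_data_def uvcwe_of_ccwm_def comp_def case_prod_beta)
qed


section \<open>Unique decodability\<close>

text \<open>The pair coding a digit starts with \<open>False\<close>, so the first pair starting
  with \<open>True\<close> ends the number.\<close>

lemma digits_cancel:
  "concat (map (\<lambda>d. [False, d]) b) @ True # r = concat (map (\<lambda>d. [False, d]) b') @ True # r' \<Longrightarrow>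
    b = b' \<and> r = r'"
proof (induction b arbitrary: b')
  case Nil
  then show ?case by (cases b') auto
next
  case (Cons d b)
  then show ?case by (cases b') auto
qed

lemma value_binary: "foldl (\<lambda>a d. 2 * a + of_bool d) 0 (binary n) = n"
proof (induction n rule: binary.induct)
  case (1 n)
  show ?case
  proof (cases "n < 2")
    case True
    then show ?thesis by (subst binary.simps) auto
  next
    case False
    have "2 * (n div 2) + of_bool (odd n) = n" by (cases "even n") auto
    with False 1 show ?thesis by (subst binary.simps) simp
  qed
qed

lemma binary_eq_iff: "binary m = binary n \<longleftrightarrow> m = n"
  by (metis value_binary)

text \<open>Numbers and lists share their brackets, so only its digit tells a number from the empty
  list.\<close>

lemma binary_neq_Nil: "binary n \<noteq> []"
  by (subst binary.simps) simp

lemma encode_start: "\<exists>z. encode d = True # False # z"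
  by (cases d) simp_all

text \<open>The remainders \<open>r\<close> and \<open>r'\<close> turn injectivity into
  prefix-freeness, which the induction needs for consecutive list entries.\<close>

lemma encode_cancel: "encode d @ r = encode d' @ r' \<Longrightarrow> d = d' \<and> r = r'"
proof (induction d arbitrary: d' r r')
  case (Num n)
  show ?case
  proof (cases d')
    case (Num n')
    with Num.prems show ?thesis
      using digits_cancel[of "binary n" "True # r" "binary n'" "True # r'"]
      by (simp add: binary_eq_iff)
  next
    case (Lst ys)
    \<comment> \<open>After the common opening bracket a number continues with \<open>False\<close>,
      a list with \<open>True\<close>.\<close>
    obtain d b where "binary n = d # b" using binary_neq_Nil by (metis list.exhaust)
    with Num.prems Lst show ?thesis
      using encode_start[of "hd ys"] by (cases ys) auto
  qed
next
  case (Lst xs)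
  show ?case
  proof (cases d')
    case (Num n')
    obtain d b where "binary n' = d # b" using binary_neq_Nil by (metis list.exhaust)
    with Lst.prems Num show ?thesis
      using encode_start[of "hd xs"] by (cases xs) auto
  next
    case d': (Lst ys)
    \<comment> \<open>Every entry starts with \<open>True, False\<close> and the closing bracket is
      \<open>True, True\<close>, so both lists must end together.\<close>
    have "xs = ys \<and> r = r'"
      if "concat (map encode xs) @ True # True # r = concat (map encode ys) @ True # True # r'"
      using Lst.IH that
    proof (induction xs arbitrary: ys)
      case Nil
      then show ?case using encode_start[of "hd ys"] by (cases ys) auto
    next
      case (Cons x xs)
      show ?case
      proof (cases ys)
        case Nil
        then show ?thesis using Cons.prems encode_start[of x] by auto
      next
        case ys: (Cons y zs)
        have "x = y \<and> concat (map encode xs) @ True # True # r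
            = concat (map encode zs) @ True # True # r'"
          using Cons.prems(1)[of x] Cons.prems(2) ys by simp
        moreover from this have "xs = zs \<and> r = r'"
          using Cons.IH[OF Cons.prems(1)[OF list.set_intros(2)]] by blast
        ultimately show ?thesis using ys by simp
      qed
    qed
    then show ?thesis using Lst.prems d' by simp
  qed
qed

lemma encode_eq_iff: "encode d = encode d' \<longleftrightarrow> d = d'"
  using encode_cancel[of d "[]" d' "[]"] by auto

section \<open>Recovering an instance from its data\<close>

lemma map_cancel:
  "map f xs = map f ys \<Longrightarrow> (\<And>x y. x \<in> set xs \<Longrightarrow> f x = f y \<Longrightarrow> x = y) \<Longrightarrow> xs = ys"
proof (induction xs arbitrary: ys)
  case (Cons x xs)
  then show ?case by (cases ys) auto
qed simp

lemma map_Num_eq_iff: "map Num xs = map Num ys \<longleftrightarrow> xs = ys"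
  by (auto dest: map_cancel)

text \<open>Tables with negative entries can share their data, so \<open>d\<close> is kept to the
  two restricted kinds; the leading tags then rule out a table for \<open>e\<close>.\<close>

lemma marginal_data_cancel:
  assumes "marginal_data d = marginal_data e" "d = Uniform \<or> (\<exists>v. d = Point v)"
  shows "d = e"
  using assms by (cases e) (auto simp: vote_data_def map_Num_eq_iff)

lemma electorate_data_cancel:
  assumes eq: "electorate_data (Independent vs) = electorate_data E"
    and vs: "\<forall>(w, d) \<in> set vs. d = Uniform \<or> (\<exists>v. d = Point v)"
  shows "E = Independent vs"
proof (cases E)
  case (Independent us)
  have "vs = us"
    by (rule map_cancel[where f = "\<lambda>(w, d). Lst [Num w, marginal_data d]"])
      (use eq vs Independent in \<open>auto dest: marginal_data_cancel\<close>)
  with Independent show ?thesis by simp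
qed (use eq in simp)

text \<open>\<open>nat\<close> cuts negative numerators off at 0, so every negative integer has the
  data of 0; the sign condition excludes these.\<close>

lemma rat_data_0_cancel:
  assumes "rat_data 0 = rat_data q" "0 \<le> q"
  shows "q = 0"
proof -
  obtain n d where nd: "quotient_of q = (n, d)" by fastforce
  then have "n \<le> 0" "d > 0" "q = of_int n / of_int d"
    using assms(1) by (auto simp: rat_data_def quotient_of_div intro: quotient_of_denom_pos)
  then have "q \<le> 0" by (simp add: divide_le_0_iff)
  with assms(2) show ?thesis by simp
qed

lemma uvcwe_data_cancel:
  assumes eq: "uvcwe_data (uvcwe_of_ccwm I) = uvcwe_data K" and "uvcwe_valid K"
  shows "K = uvcwe_of_ccwm I"
proof -
  let ?J = "uvcwe_of_ccwm I"
  have "[0..<uvcwe_candidates ?J] = [0..<uvcwe_candidates K]"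
    using eq by (simp add: uvcwe_data_def candidates_data_def map_Num_eq_iff)
  then have "uvcwe_candidates ?J = uvcwe_candidates K" by (metis diff_zero length_upt)
  moreover have "uvcwe_preferred ?J = uvcwe_preferred K"
    using eq by (simp add: uvcwe_data_def)
  moreover have "uvcwe_threshold K = 0"
    by (rule rat_data_0_cancel)
      (use assms in \<open>auto simp: uvcwe_data_def uvcwe_of_ccwm_def uvcwe_valid_def\<close>)
  moreover have "uvcwe_electorate K = uvcwe_electorate ?J"
    unfolding uvcwe_of_ccwm_def uvcwe_instance.simps
    by (rule electorate_data_cancel)
      (use eq in \<open>auto simp: uvcwe_data_def uvcwe_of_ccwm_def simp del: electorate_data.simps\<close>)
  ultimately show ?thesis by (simp add: uvcwe_of_ccwm_def)
qed


section \<open>Correctness of the reduction\<close>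

lemma set_profile_pmf:
  "set_pmf (profile_pmf m (Independent es)) =
     {vs. list_all2 (\<lambda>v e. v \<in> set_pmf (marginal_pmf m (snd e))) vs es}" (is "?L = ?R")
proof
  show "?L \<subseteq> ?R"
    by (auto simp: set_Pi_pmf PiE_dflt_def list_all2_conv_all_nth)
  show "?R \<subseteq> ?L"
  proof
    fix vs assume "vs \<in> ?R"
    then have len: "length vs = length es"
      and el: "\<And>i. i < length es \<Longrightarrow> vs ! i \<in> set_pmf (marginal_pmf m (snd (es ! i)))"
      by (auto simp: list_all2_conv_all_nth)
    \<comment> \<open>Outside the index set \<open>Pi_pmf\<close> fixes the default
      \<open>[]\<close>, so \<open>?f\<close> must take this value there.\<close>
    let ?f = "\<lambda>i. if i < length es then vs ! i else []"
    have "vs = map ?f [0..<length es]"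
      using len by (auto intro: nth_equalityI)
    moreover have "?f \<in> set_pmf (Pi_pmf {..<length es} [] (\<lambda>i. marginal_pmf m (snd (es ! i))))"
      using el by (auto simp: set_Pi_pmf PiE_dflt_def)
    ultimately show "vs \<in> ?L" by auto
  qed
qed

lemma uvcwe_yes_iff:
  "uvcwe_yes W (uvcwe_of_ccwm I) \<longleftrightarrow> ccwm_yes W I"
proof -
  let ?m = "ccwm_candidates I" and ?S = "ccwm_votes I" and ?T = "ccwm_open_weights I"
  let ?es = "map (\<lambda>(w, v). (w, Point v)) ?S @ map (\<lambda>w. (w, Uniform)) ?T"
  let ?perms = "permutations_of_set {..<?m}"
  \<comment> \<open>The support of \<open>pmf_of_set\<close> is the whole set because the set of
    permutations is finite and nonempty.\<close>
  have uniform: "set_pmf (marginal_pmf ?m Uniform) = ?perms"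
    by (simp add: set_pmf_of_set)
  have fixed: "list_all2 (\<lambda>v e. v \<in> set_pmf (marginal_pmf ?m (snd e))) vs
      (map (\<lambda>(w, v). (w, Point v)) ?S) \<longleftrightarrow> vs = map snd ?S" for vs
    by (auto simp: list_all2_conv_all_nth case_prod_beta intro: nth_equalityI)
  have free: "list_all2 (\<lambda>v e. v \<in> set_pmf (marginal_pmf ?m (snd e))) vs
      (map (\<lambda>w. (w, Uniform)) ?T) \<longleftrightarrow> length vs = length ?T \<and> set vs \<subseteq> ?perms" for vs
    using uniform by (auto simp: list_all2_conv_all_nth in_set_conv_nth subset_iff)
  have support: "set_pmf (profile_pmf ?m (Independent ?es)) =
      {map snd ?S @ vs | vs. length vs = length ?T \<and> set vs \<subseteq> ?perms}"
    unfolding set_profile_pmf list_all2_append2 fixed free by auto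
  have votes: "zip (weights (Independent ?es)) (map snd ?S @ vs) = ?S @ zip ?T vs" for vs
    by (simp add: case_prod_beta comp_def zip_map_fst_snd)
  have "uvcwe_yes W (uvcwe_of_ccwm I) \<longleftrightarrow>
      (\<exists>vs \<in> set_pmf (profile_pmf ?m (Independent ?es)).
         wins W ?m (ccwm_preferred I) (zip (weights (Independent ?es)) vs))"
    unfolding uvcwe_yes_def uvcwe_of_ccwm_def
    by (simp add: zero_less_measure_iff measure_pmf_zero_iff disjoint_iff Bex_def
        del: profile_pmf.simps weights.simps)
  also have "\<dots> \<longleftrightarrow> ccwm_yes W I"
    unfolding support ccwm_yes_def votes[symmetric] by auto
  finally show ?thesis .
qed

lemma uvcwe_valid_of_ccwm: "ccwm_valid I \<Longrightarrow> uvcwe_valid (uvcwe_of_ccwm I)"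
  by (auto simp: ccwm_valid_def uvcwe_valid_def uvcwe_of_ccwm_def)

text \<open>With \<open>A\<close> and \<open>B\<close> left open, one reduction serves the general,
  the restricted and the fixed-candidate versions alike.\<close>

lemma CCWM_reducible_UVCWE:
  assumes "\<And>I. I \<in> A \<Longrightarrow> uvcwe_of_ccwm I \<in> B"
  shows "poly_reducible (CCWM W A) (UVCWE W B)"
  unfolding poly_reducible_def
proof (intro exI[of _ "\<lambda>x. snd (transduce reduction (Before, None) x)"] conjI ballI)
  let ?f = "\<lambda>x. snd (transduce reduction (Before, None) x)"
  show "polytime ?f" by (rule polytime_transduce)
  have f: "?f (encode (ccwm_data I)) = encode (uvcwe_data (uvcwe_of_ccwm I))" for I
    using reads_instance[of I] by (simp add: reads_def)
  fix x assume "x \<in> fst (CCWM W A)"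
  then obtain I where I: "I \<in> A" "ccwm_valid I" "x = encode (ccwm_data I)"
    by (auto simp: CCWM_def)
  show "?f x \<in> fst (UVCWE W B)"
    unfolding I(3) f using I assms uvcwe_valid_of_ccwm by (auto simp: UVCWE_def)
  show "x \<in> snd (CCWM W A) \<longleftrightarrow> ?f x \<in> snd (UVCWE W B)"
  proof
    assume "x \<in> snd (CCWM W A)"
    then obtain I' where "I' \<in> A" "ccwm_valid I'" "ccwm_yes W I'" "x = encode (ccwm_data I')"
      by (auto simp: CCWM_def)
    then show "?f x \<in> snd (UVCWE W B)"
      using f assms uvcwe_valid_of_ccwm uvcwe_yes_iff by (auto simp: UVCWE_def)
  next
    assume "?f x \<in> snd (UVCWE W B)"
    then obtain K where K: "uvcwe_valid K" "uvcwe_yes W K"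
      "encode (uvcwe_data (uvcwe_of_ccwm I)) = encode (uvcwe_data K)"
      unfolding I(3) f by (auto simp: UVCWE_def)
    \<comment> \<open>\<open>K\<close> is only known to share its word with the image of
      \<open>I\<close>; its validity and unique decodability make the two equal.\<close>
    then have "K = uvcwe_of_ccwm I" by (simp add: encode_eq_iff uvcwe_data_cancel)
    with K have "ccwm_yes W I" by (simp add: uvcwe_yes_iff)
    with I show "x \<in> snd (CCWM W A)" by (auto simp: CCWM_def)
  qed
qed

lemma uvcwe_of_ccwm_restricted: "uvcwe_of_ccwm I \<in> restricted_instances"
  by (auto simp: uvcwe_of_ccwm_def restricted_instances_def)

lemma uvcwe_of_ccwm_candidates: "uvcwe_candidates (uvcwe_of_ccwm I) = ccwm_candidates I"
  by (simp add: uvcwe_of_ccwm_def)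

theorem theorem9:
  fixes W :: protocol
  shows "(NP_hard (CCWM W UNIV) \<longrightarrow>
            NP_hard (UVCWE W UNIV) \<and>
            NP_hard (UVCWE W restricted_instances)) \<and>
         (\<forall>k. NP_hard (CCWM W {I. ccwm_candidates I = k}) \<longrightarrow>
            NP_hard (UVCWE W {I. uvcwe_candidates I = k}) \<and>
            NP_hard (UVCWE W (restricted_instances \<inter> {I. uvcwe_candidates I = k})))"
  by (intro conjI allI impI; erule NP_hard_reduction; rule CCWM_reducible_UVCWE)
    (auto simp: uvcwe_of_ccwm_restricted uvcwe_of_ccwm_candidates)

end
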